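(* Let $p$ be a prime. There is a function $f$ with $f(\mathrm{nnz}) = O(\mathrm{nnz})$ such that the class $\mathcal{GS}_{\mathbb{Z}_p}$ of all (possibly rectangular) matrices over $\mathbb{Z}_p$ is efficiently $f$-reducible to the class $\mathcal{LS}_{\mathbb{Z}_p}$ of Laplacian matrices over $\mathbb{Z}_p$.
   Context: $\mathbb{Z}_p$ denotes the field with $p$ elements; field operations cost $O(1)$ time. A linear system instance is a pair $(\mathbf{M},\mathbf{c})$ with $\mathbf{M}\in\mathbb{Z}_p^{m\times n}$, $\mathbf{c}\in\mathbb{Z}_p^m$; solving it means finding $\mathbf{x}\in\mathbb{Z}_p^n$ with $\mathbf{M}\mathbf{x}=\mathbf{c}$. Its sparse complexity is $\mathcal{S}(\mathbf{M},\mathbf{c})=\mathrm{nnz}(\mathbf{M})$, the number of non-zero entries. A Laplacian matrix over $\mathbb{Z}_p$ is a matrix $\mathbf{L}\in\mathbb{Z}_p^{n\times n}$ arising from a simple undirected graph $G=(V,E)$ with edge weights $w:E\to\mathbb{Z}_p\setminus\{0\}$ via $\mathbf{L}_{a,a}=\sum_{(a,u)\in E}w_{a,u}$, $\mathbf{L}_{a,b}=-w_{a,b}$ if $(a,b)\in E$, and $0$ otherwise (equivalently, a symmetric matrix with the all-ones vector in its kernel). For matrix classes $\mathcal{M}^1,\mathcal{M}^2$ and a non-decreasing $f:\mathbb{R}_+\to\mathbb{R}_+$, $\mathcal{M}^1$ is efficiently $f$-reducible to $\mathcal{M}^2$ if there are algorithms $\mathcal{A}_{1\mapsto2}$ and $\mathcal{A}_{2\mapsto1}$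 such that for every instance $(\mathbf{M}^1,\mathbf{c}^1)$ with $\mathbf{M}^1\in\mathcal{M}^1$: $\mathcal{A}_{1\mapsto2}$ outputs an instance $(\mathbf{M}^2,\mathbf{c}^2)$ with $\mathbf{M}^2\in\mathcal{M}^2$ and $\mathcal{S}(\mathbf{M}^2,\mathbf{c}^2)\le f(\mathcal{S}(\mathbf{M}^1,\mathbf{c}^1))$; whenever $\mathbf{x}^2$ solves $(\mathbf{M}^2,\mathbf{c}^2)$, $\mathcal{A}_{2\mapsto1}(\mathbf{M}^2,\mathbf{c}^2,\mathbf{x}^2)$ is a solution of $(\mathbf{M}^1,\mathbf{c}^1)$; and both algorithms run in time $\widetilde{O}(\mathrm{nnz}(\mathbf{M}^1))$, where $\widetilde{O}$ hides $\mathrm{poly}(\log\log)$ factors. *)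

theory Defs
  imports
    "HOL-Library.Landau_Symbols"
    "Jordan_Normal_Form.Matrix"
    "Berlekamp_Zassenhaus.Finite_Field"
begin

section \<open>Linear systems and matrix classes\<close>

definition nz_positions :: "'a::zero mat \<Rightarrow> (nat \<times> nat) set" where
  "nz_positions M = {(i, j). i < dim_row M \<and> j < dim_col M \<and> M $$ (i, j) \<noteq> 0}"

definition nnz :: "'a::zero mat \<Rightarrow> nat" where
  "nnz M = card (nz_positions M)"

definition lin_instance :: "'a mat \<Rightarrow> 'a vec \<Rightarrow> bool" where
  "lin_instance M c \<longleftrightarrow> c \<in> carrier_vec (dim_row M)"

definition sparse_complexity :: "'a::zero mat \<Rightarrow> 'a vec \<Rightarrow> nat" where
  "sparse_complexity M c = nnz M"

definition solves :: "'a::semiring_0 mat \<Rightarrow> 'a vec \<Rightarrow> 'a vec \<Rightarrow> bool" where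
  "solves M c x \<longleftrightarrow> x \<in> carrier_vec (dim_col M) \<and> M *\<^sub>v x = c"

definition general_matrices :: "'a mat set" where
  "general_matrices = (\<Union>m n. carrier_mat m n)"

definition weighted_graph :: "nat \<Rightarrow> nat set set \<Rightarrow> (nat set \<Rightarrow> 'a::zero) \<Rightarrow> bool" where
  "weighted_graph n E w \<longleftrightarrow>
     (\<forall>e\<in>E. e \<subseteq> {..<n} \<and> card e = 2) \<and> (\<forall>e\<in>E. w e \<noteq> 0)"

definition graph_laplacian :: "nat \<Rightarrow> nat set set \<Rightarrow> (nat set \<Rightarrow> 'a::ab_group_add) \<Rightarrow> 'a mat" where
  "graph_laplacian n E w = mat n n (\<lambda>(a, b).
     if a = b then (\<Sum>u | {a, u} \<in> E. w {a, u})
     else if {a, b} \<in> E then - w {a, b}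
     else 0)"

definition laplacian_matrices :: "'a::ab_group_add mat set" where
  "laplacian_matrices = {graph_laplacian n E w |n E w. weighted_graph n E w}"


section \<open>A word RAM with field registers\<close>

text \<open>
  Algorithms are programs of a deeply embedded imperative language over a fixed field. A state has
  registers and arrays holding natural numbers (sizes, indices) and registers and arrays holding
  field elements. A program mentions only finitely many registers and arrays, so this is a
  random access machine whose memory is split into finitely many segments.
\<close>

record 'a state =
  nreg :: "string \<Rightarrow> nat"
  freg :: "string \<Rightarrow> 'a"
  narr :: "string \<Rightarrow> nat \<Rightarrow> nat"
  farr :: "string \<Rightarrow> nat \<Rightarrow> 'a"

datatype nexp =
    NConst nat | NReg string | NLoad string nexp
  | NAdd nexp nexp | NSub nexp nexp

datatype 'a fexp =
    FConst 'a | FReg string | FLoad string nexp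
  | FAdd "'a fexp" "'a fexp" | FSub "'a fexp" "'a fexp"
  | FMul "'a fexp" "'a fexp" | FInv "'a fexp"

datatype 'a bexp =
    NEq nexp nexp | NLess nexp nexp | FEq "'a fexp" "'a fexp"
  | BNot "'a bexp" | BAnd "'a bexp" "'a bexp"

datatype 'a com =
    Skip
  | NSet string nexp
  | NStore string nexp nexp
  | FSet string "'a fexp"
  | FStore string nexp "'a fexp"
  | Seq "'a com" "'a com"
  | If "'a bexp" "'a com" "'a com"
  | While "'a bexp" "'a com"

text \<open>Subtraction of natural numbers is truncated, and the inverse of \<open>0\<close> is \<open>0\<close>.\<close>

fun neval :: "'a state \<Rightarrow> nexp \<Rightarrow> nat" where
  "neval s (NConst k) = k"
| "neval s (NReg r) = nreg s r"
| "neval s (NLoad a e) = narr s a (neval s e)"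
| "neval s (NAdd e e') = neval s e + neval s e'"
| "neval s (NSub e e') = neval s e - neval s e'"

fun feval :: "'a::field state \<Rightarrow> 'a fexp \<Rightarrow> 'a" where
  "feval s (FConst v) = v"
| "feval s (FReg r) = freg s r"
| "feval s (FLoad a e) = farr s a (neval s e)"
| "feval s (FAdd e e') = feval s e + feval s e'"
| "feval s (FSub e e') = feval s e - feval s e'"
| "feval s (FMul e e') = feval s e * feval s e'"
| "feval s (FInv e) = inverse (feval s e)"

fun beval :: "'a::field state \<Rightarrow> 'a bexp \<Rightarrow> bool" where
  "beval s (NEq e e') \<longleftrightarrow> neval s e = neval s e'"
| "beval s (NLess e e') \<longleftrightarrow> neval s e < neval s e'"
| "beval s (FEq e e') \<longleftrightarrow> feval s e = feval s e'"
| "beval s (BNot b) \<longleftrightarrow> \<not> beval s b"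
| "beval s (BAnd b b') \<longleftrightarrow> beval s b \<and> beval s b'"

text \<open>
  \<open>exec W c s t s'\<close>: started in \<open>s\<close>, the program \<open>c\<close> halts in \<open>s'\<close> after \<open>t\<close> steps on a machine
  whose words hold the numbers up to \<open>W\<close>. A program that tries to store a larger number, or to store
  at a larger address, is stuck, so unit-cost arithmetic cannot be abused with huge numbers.
  Each elementary command or test costs one step; the expressions in it have a size fixed by the
  program, so this is unit cost for field operations, index operations and memory accesses up to a
  constant factor depending on the program only.
\<close>

inductive exec :: "nat \<Rightarrow> 'a::field com \<Rightarrow> 'a state \<Rightarrow> nat \<Rightarrow> 'a state \<Rightarrow> bool" for W :: nat where
  Skip: "exec W Skip s 1 s"
| NSet: "neval s e \<le> W \<Longrightarrow>
    exec W (NSet r e) s 1 (s\<lparr>nreg := (nreg s)(r := neval s e)\<rparr>)"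
| NStore: "neval s i \<le> W \<Longrightarrow> neval s e \<le> W \<Longrightarrow>
    exec W (NStore a i e) s 1 (s\<lparr>narr := (narr s)(a := (narr s a)(neval s i := neval s e))\<rparr>)"
| FSet: "exec W (FSet r e) s 1 (s\<lparr>freg := (freg s)(r := feval s e)\<rparr>)"
| FStore: "neval s i \<le> W \<Longrightarrow>
    exec W (FStore a i e) s 1 (s\<lparr>farr := (farr s)(a := (farr s a)(neval s i := feval s e))\<rparr>)"
| Seq: "exec W c1 s t1 s1 \<Longrightarrow> exec W c2 s1 t2 s2 \<Longrightarrow> exec W (Seq c1 c2) s (t1 + t2) s2"
| IfTrue: "beval s b \<Longrightarrow> exec W c1 s t s' \<Longrightarrow> exec W (If b c1 c2) s (t + 1) s'"
| IfFalse: "\<not> beval s b \<Longrightarrow> exec W c2 s t s' \<Longrightarrow> exec W (If b c1 c2) s (t + 1) s'"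
| WhileFalse: "\<not> beval s b \<Longrightarrow> exec W (While b c) s 1 s"
| WhileTrue: "beval s b \<Longrightarrow> exec W c s t1 s1 \<Longrightarrow> exec W (While b c) s1 t2 s2 \<Longrightarrow>
    exec W (While b c) s (t1 + t2 + 1) s2"

inductive_cases exec_SkipE: "exec W Skip s t s'"
  and exec_NSetE: "exec W (NSet r e) s t s'"
  and exec_NStoreE: "exec W (NStore a i e) s t s'"
  and exec_FSetE: "exec W (FSet r f) s t s'"
  and exec_FStoreE: "exec W (FStore a i f) s t s'"
  and exec_SeqE: "exec W (Seq c1 c2) s t s'"
  and exec_IfE: "exec W (If b c1 c2) s t s'"
  and exec_WhileE: "exec W (While b c) s t s'"

lemma exec_deterministic:
  "exec W c s t s' \<Longrightarrow> exec W c s u s'' \<Longrightarrow> u = t \<and> s'' = s'"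
proof (induction arbitrary: u s'' rule: exec.induct)
  case Skip then show ?case by (elim exec_SkipE) simp
next
  case NSet from NSet.prems show ?case by (elim exec_NSetE) simp
next
  case NStore from NStore.prems show ?case by (elim exec_NStoreE) simp
next
  case FSet from FSet.prems show ?case by (elim exec_FSetE) simp
next
  case FStore from FStore.prems show ?case by (elim exec_FStoreE) simp
next
  case (Seq c1 s t1 s1 c2 t2 s2)
  from Seq.prems obtain v1 r v2 where "u = v1 + v2" "exec W c1 s v1 r" "exec W c2 r v2 s''"
    by (rule exec_SeqE)
  then show ?case using Seq.IH(1)[of v1 r] Seq.IH(2)[of v2 s''] by simp
next
  case (IfTrue s b c1 t s' c2)
  from IfTrue.prems IfTrue.hyps(1) obtain v where "u = v + 1" "exec W c1 s v s''"
    by (elim exec_IfE) simp_all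
  then show ?case using IfTrue.IH[of v s''] by simp
next
  case (IfFalse s b c2 t s' c1)
  from IfFalse.prems IfFalse.hyps(1) obtain v where "u = v + 1" "exec W c2 s v s''"
    by (elim exec_IfE) simp_all
  then show ?case using IfFalse.IH[of v s''] by simp
next
  case (WhileFalse s b c)
  from WhileFalse.prems show ?case by (rule exec_WhileE) (simp_all add: WhileFalse.hyps)
next
  case (WhileTrue s b c t1 s1 t2 s2)
  from WhileTrue.prems obtain v1 r v2 where
    "u = v1 + v2 + 1" "exec W c s v1 r" "exec W (While b c) r v2 s''"
    by (rule exec_WhileE) (simp_all add: WhileTrue.hyps(1))
  then show ?case using WhileTrue.IH(1)[of v1 r] WhileTrue.IH(2)[of v2 s''] by simp
qed


section \<open>Input and output conventions\<close>

text \<open>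
  A matrix is stored in coordinate format: its dimensions, the number of its non-zero entries, and
  the positions and values of the non-zero entries in some arbitrary order, each exactly once.
  Vectors are stored entry by entry in arrays. Memory not used by the input is initially zero.
  In \<open>input_state M c ps\<close>, the list \<open>ps\<close> enumerates the positions of the non-zero entries.
\<close>

definition enumerates_nz :: "'a::zero mat \<Rightarrow> (nat \<times> nat) list \<Rightarrow> bool" where
  "enumerates_nz M ps \<longleftrightarrow> distinct ps \<and> set ps = nz_positions M"

definition input_state :: "'a::zero mat \<Rightarrow> 'a vec \<Rightarrow> (nat \<times> nat) list \<Rightarrow> 'a state" where
  "input_state M c ps = \<lparr>
     nreg = (\<lambda>_. 0)(''rows'' := dim_row M, ''cols'' := dim_col M, ''nnz'' := length ps),
     freg = (\<lambda>_. 0),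
     narr = (\<lambda>_ _. 0)
       (''row'' := (\<lambda>k. if k < length ps then fst (ps ! k) else 0),
        ''col'' := (\<lambda>k. if k < length ps then snd (ps ! k) else 0)),
     farr = (\<lambda>_ _. 0)
       (''val'' := (\<lambda>k. if k < length ps then M $$ (ps ! k) else 0),
        ''rhs'' := (\<lambda>i. if i < dim_vec c then c $ i else 0))\<rparr>"

definition input_state_sol ::
    "'a::zero mat \<Rightarrow> 'a vec \<Rightarrow> (nat \<times> nat) list \<Rightarrow> 'a vec \<Rightarrow> 'a state" where
  "input_state_sol M c ps x =
     (let s = input_state M c ps
      in s\<lparr>farr := (farr s)(''sol'' := (\<lambda>j. if j < dim_vec x then x $ j else 0))\<rparr>)"

text \<open>An output instance is left in the same registers and arrays; the rest is arbitrary.\<close>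

definition outputs_instance :: "'a::zero state \<Rightarrow> 'a mat \<Rightarrow> 'a vec \<Rightarrow> bool" where
  "outputs_instance s M c \<longleftrightarrow> lin_instance M c \<and>
     nreg s ''rows'' = dim_row M \<and> nreg s ''cols'' = dim_col M \<and>
     enumerates_nz M (map (\<lambda>k. (narr s ''row'' k, narr s ''col'' k)) [0..<nreg s ''nnz'']) \<and>
     (\<forall>k < nreg s ''nnz''. farr s ''val'' k = M $$ (narr s ''row'' k, narr s ''col'' k)) \<and>
     (\<forall>i < dim_row M. farr s ''rhs'' i = c $ i)"

definition output_vector :: "nat \<Rightarrow> 'a state \<Rightarrow> 'a vec" where
  "output_vector n s = vec n (farr s ''out'')"

text \<open>
  The largest number fitting in a word when words have about \<open>k \<cdot> log\<^sub>2 N\<close> bits, where \<open>N\<close> is the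
  sum of the dimensions and of the number of non-zero entries of the input matrix.
\<close>

definition word_bound :: "nat \<Rightarrow> 'a::zero mat \<Rightarrow> nat" where
  "word_bound k M = (dim_row M + dim_col M + nnz M + 2) ^ k"


section \<open>Efficient reducibility\<close>

text \<open>\<open>soft_O g\<close> is $\widetilde O(g)$, hiding factors polynomial in $\log\log g$.\<close>

definition soft_O :: "(nat \<Rightarrow> real) \<Rightarrow> (nat \<Rightarrow> real) set" where
  "soft_O g = (\<Union>k::nat. O(\<lambda>N. g N * ln (ln (g N)) ^ k))"

text \<open>
  In \<open>efficient_reduction\<close>, the second program receives only the produced instance and a solution
  of it, in fresh memory and with the non-zero entries listed in any order. The clause on solvable
  instances rules out the degenerate program that maps every instance to an unsolvable one, for
  which the condition on the second program would be void.
\<close>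

definition efficient_reduction ::
    "(real \<Rightarrow> real) \<Rightarrow> 'a::field mat set \<Rightarrow> 'a mat set \<Rightarrow> 'a com \<Rightarrow> 'a com \<Rightarrow> bool" where
  "efficient_reduction f \<M>1 \<M>2 A12 A21 \<longleftrightarrow>
     (\<exists>T \<in> soft_O real. \<exists>k.
        \<forall>M1 \<in> \<M>1. \<forall>c1 ps1. lin_instance M1 c1 \<longrightarrow> enumerates_nz M1 ps1 \<longrightarrow>
          (\<exists>t s M2 c2.
             exec (word_bound k M1) A12 (input_state M1 c1 ps1) t s \<and>
             real t \<le> T (nnz M1) \<and>
             outputs_instance s M2 c2 \<and>
             M2 \<in> \<M>2 \<and>
             real (sparse_complexity M2 c2) \<le> f (real (sparse_complexity M1 c1)) \<and>
             ((\<exists>x1. solves M1 c1 x1) \<longrightarrow> (\<exists>x2. solves M2 c2 x2)) \<and>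
             (\<forall>x2 ps2. solves M2 c2 x2 \<longrightarrow> enumerates_nz M2 ps2 \<longrightarrow>
                (\<exists>t' s'.
                   exec (word_bound k M2) A21 (input_state_sol M2 c2 ps2 x2) t' s' \<and>
                   real t' \<le> T (nnz M1) \<and>
                   solves M1 c1 (output_vector (dim_col M1) s')))))"

definition efficiently_reducible ::
    "(real \<Rightarrow> real) \<Rightarrow> 'a::field mat set \<Rightarrow> 'a mat set \<Rightarrow> bool" where
  "efficiently_reducible f \<M>1 \<M>2 \<longleftrightarrow>
     f \<in> {0..} \<rightarrow> {0..} \<and> mono_on {0..} f \<and>
     (\<exists>A12 A21. efficient_reduction f \<M>1 \<M>2 A12 A21)"

end

theory Submission
  imports Defs
begin

text \<open>
  Replace every row \<open>i\<close> of \<open>M\<close> by two vertices \<open>i\<^sup>+, i\<^sup>-\<close> and every column \<open>j\<close> by two vertices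
  \<open>j\<^sup>+, j\<^sup>-\<close>, and every entry \<open>M\<^sub>i\<^sub>j\<close> by the block \<open>M\<^sub>i\<^sub>j * [[1, -1], [-1, 1]]\<close>. The symmetric matrix with
  these blocks off the diagonal has vanishing row sums and a vanishing diagonal, since over a field
  without an order edge weights may cancel. Its equation at \<open>i\<^sup>+\<close> is the \<open>i\<close>-th equation of \<open>M\<close> in the
  differences \<open>x\<^sub>j = z(j\<^sup>+) - z(j\<^sup>-)\<close>, its equation at \<open>i\<^sup>-\<close> is the negated one, and its equations at the
  columns are satisfied whenever \<open>z\<close> vanishes on the rows.

  The time bound does not allow the programs to visit empty rows and columns. So \<open>i\<^sup>+\<close> is vertex \<open>i\<close>,
  which leaves all right-hand sides in place, and \<open>j\<^sup>+\<close> is counted from the last vertex, so that \<open>j\<close> can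
  be read off it without knowing the original dimensions. The second program also needs the distance
  from \<open>j\<^sup>-\<close> to \<open>j\<^sup>+\<close>, which is encoded as the length of one extra isolated edge.
\<close>

section \<open>Laplacian matrices\<close>

text \<open>The edges are the non-zero off-diagonal positions and the weights the negated entries.
  Vanishing row sums then force the diagonal to be the weighted degree.\<close>

lemma laplacian_matricesI:
  fixes A :: "'a::ab_group_add mat"
  assumes A: "A \<in> carrier_mat N N"
    and sym: "\<And>a b. a < N \<Longrightarrow> b < N \<Longrightarrow> A $$ (a, b) = A $$ (b, a)"
    and rows: "\<And>a. a < N \<Longrightarrow> (\<Sum>b<N. A $$ (a, b)) = 0"
  shows "A \<in> laplacian_matrices"
proof -
  define E where "E = {{a, b} |a b. a < N \<and> b < N \<and> a \<noteq> b \<and> A $$ (a, b) \<noteq> 0}"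
  \<comment> \<open>Weights live on unordered pairs, so an endpoint order must be chosen; by
    symmetry the choice is immaterial.\<close>
  define w where "w e = - A $$ (Min e, Max e)" for e
  have w: "w {a, b} = - A $$ (a, b)" if "a < N" "b < N" for a b
    using that sym[of a b] unfolding w_def by (cases "a \<le> b") auto
  have E: "{a, b} \<in> E \<longleftrightarrow> a < N \<and> b < N \<and> a \<noteq> b \<and> A $$ (a, b) \<noteq> 0" for a b
    unfolding E_def using sym by (auto simp: doubleton_eq_iff)
  have wg: "weighted_graph N E w"
    unfolding weighted_graph_def
  proof (intro conjI ballI)
    fix e assume "e \<in> E"
    then obtain a b where e: "e = {a, b}" "a < N" "b < N" "a \<noteq> b" "A $$ (a, b) \<noteq> 0"
      unfolding E_def by blast
    then show "e \<subseteq> {..<N}" "card e = 2" "w e \<noteq> 0" using w by auto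
  qed
  have "A = graph_laplacian N E w"
  proof (rule eq_matI)
    fix a b assume "a < dim_row (graph_laplacian N E w)" "b < dim_col (graph_laplacian N E w)"
    then have ab: "a < N" "b < N" by (auto simp: graph_laplacian_def)
    show "A $$ (a, b) = graph_laplacian N E w $$ (a, b)"
    proof (cases "a = b")
      case True
      \<comment> \<open>Non-neighbours of \<open>a\<close> other than \<open>a\<close> itself
        contribute zero entries, so the degree is minus the off-diagonal row sum.\<close>
      have "(\<Sum>u | {a, u} \<in> E. w {a, u}) = (\<Sum>u\<in>{..<N} - {a}. - A $$ (a, u))"
        by (rule sum.mono_neutral_cong_left) (use ab E w in auto)
      also have "\<dots> = A $$ (a, a)"
        using rows[OF ab(1)] ab by (simp add: sum_negf sum.remove[of "{..<N}" a] add_eq_0_iff)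
      finally show ?thesis using True ab by (simp add: graph_laplacian_def)
    qed (use ab E w in \<open>auto simp: graph_laplacian_def\<close>)
  qed (use A in \<open>auto simp: graph_laplacian_def\<close>)
  then show ?thesis using wg unfolding laplacian_matrices_def by blast
qed

section \<open>The Laplacian of a rectangular matrix\<close>

text \<open>
  For \<open>i < m\<close> and \<open>j < n\<close>, vertex \<open>i\<close> is \<open>i\<^sup>+\<close>, \<open>m + i\<close> is \<open>i\<^sup>-\<close>, \<open>2 * m + n - 1 - j\<close> is \<open>j\<^sup>-\<close> and
  \<open>2 * m + 2 * n - j\<close> is \<open>j\<^sup>+\<close>; the ends of the extra edge are \<open>2 * m + n\<close> and \<open>2 * m + 2 * n + 1\<close>.
\<close>

definition row_sign :: "nat \<Rightarrow> nat \<Rightarrow> 'a::field" where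
  "row_sign m r = (if r < m then 1 else if r < 2 * m then - 1 else 0)"

definition row_index :: "nat \<Rightarrow> nat \<Rightarrow> nat" where
  "row_index m r = (if r < m then r else r - m)"

definition col_sign :: "nat \<Rightarrow> nat \<Rightarrow> nat \<Rightarrow> 'a::field" where
  "col_sign m n c = (if 2 * m + n < c \<and> c \<le> 2 * m + 2 * n then 1
     else if 2 * m \<le> c \<and> c < 2 * m + n then - 1 else 0)"

definition col_index :: "nat \<Rightarrow> nat \<Rightarrow> nat \<Rightarrow> nat" where
  "col_index m n c = (if 2 * m + n < c then 2 * m + 2 * n - c else 2 * m + n - 1 - c)"

text \<open>The vector whose outer product with itself is the Laplacian of one edge of weight 1, the
  extra edge.\<close>

definition mark_sign :: "nat \<Rightarrow> nat \<Rightarrow> nat \<Rightarrow> 'a::field" where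
  "mark_sign m n r = (if r = 2 * m + 2 * n + 1 then 1 else if r = 2 * m + n then - 1 else 0)"

abbreviation lap_dim :: "nat \<Rightarrow> nat \<Rightarrow> nat" where
  "lap_dim m n \<equiv> 2 * m + 2 * n + 2"

text \<open>The signs vanish away from row vertices and column vertices respectively, so the values
  of \<open>M\<close> at meaningless decoded indices are multiplied by 0.\<close>

definition lap_block :: "'a::field mat \<Rightarrow> nat \<Rightarrow> nat \<Rightarrow> 'a" where
  "lap_block M r c = row_sign (dim_row M) r * col_sign (dim_row M) (dim_col M) c *
     M $$ (row_index (dim_row M) r, col_index (dim_row M) (dim_col M) c)"

definition lap_of :: "'a::field mat \<Rightarrow> 'a mat" where
  "lap_of M = (let m = dim_row M; n = dim_col M in
     mat (lap_dim m n) (lap_dim m n)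
       (\<lambda>(r, c). lap_block M r c + lap_block M c r + mark_sign m n r * mark_sign m n c))"

lemma lap_of_carrier:
  "lap_of M \<in> carrier_mat (lap_dim (dim_row M) (dim_col M)) (lap_dim (dim_row M) (dim_col M))"
  by (simp add: lap_of_def Let_def)

lemma dim_lap_of [simp]:
  "dim_row (lap_of M) = lap_dim (dim_row M) (dim_col M)"
  "dim_col (lap_of M) = lap_dim (dim_row M) (dim_col M)"
  by (simp_all add: lap_of_def Let_def)

lemma lap_of_index:
  "r < lap_dim (dim_row M) (dim_col M) \<Longrightarrow> c < lap_dim (dim_row M) (dim_col M) \<Longrightarrow>
   lap_of M $$ (r, c) = lap_block M r c + lap_block M c r +
     mark_sign (dim_row M) (dim_col M) r * mark_sign (dim_row M) (dim_col M) c"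
  by (simp add: lap_of_def Let_def)

section \<open>Row sums of \<open>lap_of\<close> and its action on vectors\<close>

lemma sum_row_sign:
  fixes g :: "nat \<Rightarrow> nat \<Rightarrow> 'a::field"
  shows "(\<Sum>c<lap_dim m n. row_sign m c * g (row_index m c) c) = (\<Sum>i<m. g i i - g i (m + i))"
proof -
  have "(\<Sum>c<lap_dim m n. row_sign m c * g (row_index m c) c) =
      (\<Sum>c\<in>{..<m} \<union> {m..<2 * m}. row_sign m c * g (row_index m c) c)"
    by (rule sum.mono_neutral_right) (auto simp: row_sign_def)
  also have "\<dots> = (\<Sum>c<m. row_sign m c * g (row_index m c) c) +
      (\<Sum>c\<in>{m..<2 * m}. row_sign m c * g (row_index m c) c)"
    by (rule sum.union_disjoint) auto
  also have "(\<Sum>c<m. row_sign m c * g (row_index m c) c) = (\<Sum>i<m. g i i)"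
    by (simp add: row_sign_def row_index_def)
  also have "(\<Sum>c\<in>{m..<2 * m}. row_sign m c * g (row_index m c) c) = (\<Sum>i<m. - g i (m + i))"
    by (rule sum.reindex_bij_witness[of _ "\<lambda>i. m + i" "\<lambda>c. c - m"])
      (auto simp: row_sign_def row_index_def)
  finally show ?thesis by (simp add: sum_subtractf sum_negf)
qed

text \<open>The argument \<open>g\<close> receives both the decoded index and the vertex, so that it
  can combine an entry of \<open>M\<close> with a value attached to the vertex.\<close>

lemma sum_col_sign:
  fixes g :: "nat \<Rightarrow> nat \<Rightarrow> 'a::field"
  shows "(\<Sum>c<lap_dim m n. col_sign m n c * g (col_index m n c) c) =
    (\<Sum>j<n. g j (2 * m + 2 * n - j) - g j (2 * m + n - 1 - j))"
proof -
  let ?f = "\<lambda>c. col_sign m n c * g (col_index m n c) c"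
  have "(\<Sum>c<lap_dim m n. ?f c) = (\<Sum>c\<in>{2*m+n<..2*m+2*n} \<union> {2*m..<2*m+n}. ?f c)"
    by (rule sum.mono_neutral_right) (auto simp: col_sign_def)
  also have "\<dots> = (\<Sum>c\<in>{2*m+n<..2*m+2*n}. ?f c) + (\<Sum>c\<in>{2*m..<2*m+n}. ?f c)"
    by (rule sum.union_disjoint) auto
  also have "(\<Sum>c\<in>{2*m+n<..2*m+2*n}. ?f c) = (\<Sum>j<n. g j (2 * m + 2 * n - j))"
    by (rule sum.reindex_bij_witness[of _ "\<lambda>j. 2*m+2*n-j" "\<lambda>c. 2*m+2*n-c"])
      (auto simp: col_sign_def col_index_def)
  also have "(\<Sum>c\<in>{2*m..<2*m+n}. ?f c) = (\<Sum>j<n. - g j (2 * m + n - 1 - j))"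
    by (rule sum.reindex_bij_witness[of _ "\<lambda>j. 2*m+n-1-j" "\<lambda>c. 2*m+n-1-c"])
      (auto simp: col_sign_def col_index_def)
  finally show ?thesis by (simp add: sum_subtractf sum_negf)
qed

lemma sum_mark_sign:
  fixes g :: "nat \<Rightarrow> 'a::field"
  shows "(\<Sum>c<lap_dim m n. mark_sign m n c * g c) = g (2 * m + 2 * n + 1) - g (2 * m + n)"
proof -
  have "(\<Sum>c<lap_dim m n. mark_sign m n c * g c) =
      (\<Sum>c\<in>{2 * m + 2 * n + 1, 2 * m + n}. mark_sign m n c * g c)"
    by (rule sum.mono_neutral_right) (auto simp: mark_sign_def)
  then show ?thesis by (simp add: mark_sign_def)
qed

text \<open>Each of the three summands of an entry is a sign depending on \<open>r\<close> times a
  sign depending on \<open>c\<close>, so the sum factorizes. Taking a function \<open>z\<close>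
  instead of a vector serves two purposes: \<open>z = 1\<close> gives vanishing row sums, and a
  vector gives the product \<open>lap_of M *\<^sub>v z\<close>.\<close>

lemma lap_of_row_sum:
  fixes M :: "'a::field mat"
  defines "m \<equiv> dim_row M" and "n \<equiv> dim_col M"
  assumes r: "r < lap_dim m n"
  shows "(\<Sum>c<lap_dim m n. lap_of M $$ (r, c) * z c) =
    row_sign m r * (\<Sum>j<n. M $$ (row_index m r, j) * (z (2 * m + 2 * n - j) - z (2 * m + n - 1 - j)))
    + col_sign m n r * (\<Sum>i<m. M $$ (i, col_index m n r) * (z i - z (m + i)))
    + mark_sign m n r * (z (2 * m + 2 * n + 1) - z (2 * m + n))"
proof -
  have "(\<Sum>c<lap_dim m n. lap_of M $$ (r, c) * z c) =
     row_sign m r * (\<Sum>c<lap_dim m n. col_sign m n c * (M $$ (row_index m r, col_index m n c) * z c))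
   + col_sign m n r * (\<Sum>c<lap_dim m n. row_sign m c * (M $$ (row_index m c, col_index m n r) * z c))
   + mark_sign m n r * (\<Sum>c<lap_dim m n. mark_sign m n c * z c)"
    using r unfolding sum_distrib_left sum.distrib[symmetric] m_def n_def
    by (intro sum.cong refl) (simp add: lap_of_index lap_block_def algebra_simps)
  then show ?thesis
    by (simp only: sum_mark_sign
      sum_row_sign[where g = "\<lambda>i c. M $$ (i, col_index m n r) * z c"]
      sum_col_sign[where g = "\<lambda>j c. M $$ (row_index m r, j) * z c"] right_diff_distrib)
qed

lemma lap_of_laplacian: "lap_of M \<in> laplacian_matrices"
proof (rule laplacian_matricesI[OF lap_of_carrier])
  fix a assume "a < lap_dim (dim_row M) (dim_col M)"
  from lap_of_row_sum[OF this, of "\<lambda>_. 1"]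
  show "(\<Sum>b<lap_dim (dim_row M) (dim_col M). lap_of M $$ (a, b)) = 0" by simp
qed (simp add: lap_of_index)

lemma lap_of_mult_vec:
  fixes M :: "'a::field mat"
  defines "m \<equiv> dim_row M" and "n \<equiv> dim_col M"
  assumes r: "r < lap_dim m n" and z: "dim_vec z = lap_dim m n"
  shows "(lap_of M *\<^sub>v z) $ r =
    row_sign m r * (\<Sum>j<n. M $$ (row_index m r, j) * (z $ (2 * m + 2 * n - j) - z $ (2 * m + n - 1 - j)))
    + col_sign m n r * (\<Sum>i<m. M $$ (i, col_index m n r) * (z $ i - z $ (m + i)))
    + mark_sign m n r * (z $ (2 * m + 2 * n + 1) - z $ (2 * m + n))"
  using r z lap_of_row_sum[of r M "\<lambda>c. z $ c"] unfolding m_def n_def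
  by (simp add: scalar_prod_def lessThan_atLeast0)

section \<open>Positions of the non-zero entries of \<open>lap_of\<close>\<close>

definition lap_cells :: "nat \<Rightarrow> nat \<Rightarrow> nat \<times> nat \<Rightarrow> (nat \<times> nat) list" where
  "lap_cells m n = (\<lambda>(i, j). let p = 2 * m + 2 * n - j; q = 2 * m + n - 1 - j in
     [(i, p), (i, q), (m + i, p), (m + i, q), (p, i), (q, i), (p, m + i), (q, m + i)])"

definition mark_cells :: "nat \<Rightarrow> nat \<Rightarrow> (nat \<times> nat) list" where
  "mark_cells m n = (let a = 2 * m + 2 * n + 1; b = 2 * m + n in [(a, a), (a, b), (b, a), (b, b)])"

lemma length_lap_cells [simp]: "length (lap_cells m n p) = 8"
  by (simp add: lap_cells_def Let_def split: prod.split)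

lemma lap_of_cells:
  fixes M :: "'a::field mat"
  defines "m \<equiv> dim_row M" and "n \<equiv> dim_col M"
  assumes "i < m" "j < n"
  shows "lap_of M $$ (i, 2 * m + 2 * n - j) = M $$ (i, j)"
    "lap_of M $$ (i, 2 * m + n - Suc j) = - M $$ (i, j)"
    "lap_of M $$ (m + i, 2 * m + 2 * n - j) = - M $$ (i, j)"
    "lap_of M $$ (m + i, 2 * m + n - Suc j) = M $$ (i, j)"
    "lap_of M $$ (2 * m + 2 * n - j, i) = M $$ (i, j)"
    "lap_of M $$ (2 * m + n - Suc j, i) = - M $$ (i, j)"
    "lap_of M $$ (2 * m + 2 * n - j, m + i) = - M $$ (i, j)"
    "lap_of M $$ (2 * m + n - Suc j, m + i) = M $$ (i, j)"
  using assms
  by (auto simp: lap_of_index lap_block_def row_sign_def col_sign_def mark_sign_def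
      row_index_def col_index_def)

lemma lap_of_mark_cells:
  fixes M :: "'a::field mat"
  defines "m \<equiv> dim_row M" and "n \<equiv> dim_col M"
  shows "lap_of M $$ (Suc (2 * m + 2 * n), Suc (2 * m + 2 * n)) = 1"
    "lap_of M $$ (Suc (2 * m + 2 * n), 2 * m + n) = - 1"
    "lap_of M $$ (2 * m + n, Suc (2 * m + 2 * n)) = - 1"
    "lap_of M $$ (2 * m + n, 2 * m + n) = 1"
  unfolding assms
  by (auto simp: lap_of_index lap_block_def row_sign_def col_sign_def mark_sign_def)

lemma lap_of_nonzeroD:
  fixes M :: "'a::field mat"
  assumes rc: "(r, c) \<in> nz_positions (lap_of M)"
  shows "(\<exists>p\<in>nz_positions M. (r, c) \<in> set (lap_cells (dim_row M) (dim_col M) p)) \<or>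
    (r, c) \<in> set (mark_cells (dim_row M) (dim_col M))"
proof -
  let ?m = "dim_row M" and ?n = "dim_col M"
  \<comment> \<open>Both orders of the pair are recorded, so the transposed summand
    \<open>lap_block M c r\<close> is covered by exchanging \<open>r\<close> and
    \<open>c\<close>.\<close>
  have block: "\<exists>p\<in>nz_positions M. (r, c) \<in> set (lap_cells ?m ?n p) \<and>
      (c, r) \<in> set (lap_cells ?m ?n p)" if "lap_block M r c \<noteq> 0" for r c
  proof -
    have r: "row_sign ?m r \<noteq> (0::'a)" and c: "col_sign ?m ?n c \<noteq> (0::'a)"
      and x: "M $$ (row_index ?m r, col_index ?m ?n c) \<noteq> 0"
      using that by (auto simp: lap_block_def)
    let ?i = "row_index ?m r" and ?j = "col_index ?m ?n c"
    have "?i < ?m \<and> (r = ?i \<or> r = ?m + ?i)"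
      using r by (auto simp: row_sign_def row_index_def split: if_splits)
    moreover have "?j < ?n \<and> (c = 2 * ?m + 2 * ?n - ?j \<or> c = 2 * ?m + ?n - 1 - ?j)"
      using c by (auto simp: col_sign_def col_index_def split: if_splits)
    ultimately have "(?i, ?j) \<in> nz_positions M \<and> (r, c) \<in> set (lap_cells ?m ?n (?i, ?j)) \<and>
        (c, r) \<in> set (lap_cells ?m ?n (?i, ?j))"
      using x unfolding nz_positions_def lap_cells_def Let_def by auto
    then show ?thesis by blast
  qed
  have "lap_block M r c \<noteq> 0 \<or> lap_block M c r \<noteq> 0 \<or>
      mark_sign ?m ?n r * mark_sign ?m ?n c \<noteq> (0::'a)"
    using rc by (auto simp: nz_positions_def lap_of_index)
  then show ?thesis
    using block[of r c] block[of c r]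
    by (auto simp: mark_cells_def mark_sign_def Let_def split: if_splits)
qed

lemma nz_positions_lap_of:
  fixes M :: "'a::field mat"
  defines "m \<equiv> dim_row M" and "n \<equiv> dim_col M"
  shows "nz_positions (lap_of M) = (\<Union>p\<in>nz_positions M. set (lap_cells m n p)) \<union> set (mark_cells m n)"
    (is "?L = ?R")
proof
  show "?L \<subseteq> ?R"
  proof (rule subrelI)
    fix r c assume "(r, c) \<in> ?L"
    from lap_of_nonzeroD[OF this] show "(r, c) \<in> ?R" unfolding m_def n_def by blast
  qed
  have "set (lap_cells m n (i, j)) \<subseteq> ?L" if "i < m" "j < n" "M $$ (i, j) \<noteq> 0" for i j
    using lap_of_cells[of i M j] that
    by (auto simp: lap_cells_def Let_def m_def n_def nz_positions_def)
  then have "(\<Union>p\<in>nz_positions M. set (lap_cells m n p)) \<subseteq> ?L"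
    by (fastforce simp: m_def n_def nz_positions_def[of M])
  moreover have "set (mark_cells m n) \<subseteq> ?L"
    using lap_of_mark_cells[of M] by (simp add: mark_cells_def Let_def m_def n_def nz_positions_def)
  ultimately show "?R \<subseteq> ?L" by blast
qed

lemma distinct_concat_map:
  assumes "distinct xs" "\<And>x. x \<in> set xs \<Longrightarrow> distinct (f x)"
    "\<And>x y. x \<in> set xs \<Longrightarrow> y \<in> set xs \<Longrightarrow> x \<noteq> y \<Longrightarrow> set (f x) \<inter> set (f y) = {}"
  shows "distinct (concat (map f xs))"
  using assms by (induction xs) (auto simp: disjoint_iff)

text \<open>Row vertices lie below \<open>2 * m\<close> and column vertices do not, and a vertex
  determines its index; hence the cells of different entries are disjoint. The extra edge uses the
  two numbers that the row and column vertices leave free.\<close>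

lemma enumerates_lap_of:
  fixes M :: "'a::field mat"
  defines "m \<equiv> dim_row M" and "n \<equiv> dim_col M"
  assumes ps: "enumerates_nz M ps"
  shows "enumerates_nz (lap_of M) (concat (map (lap_cells m n) ps) @ mark_cells m n)"
proof -
  have set_ps: "set ps = nz_positions M" and "distinct ps"
    using ps by (auto simp: enumerates_nz_def)
  have bound: "fst p < m" "snd p < n" if "p \<in> set ps" for p
    using that unfolding set_ps nz_positions_def m_def n_def by auto
  have "distinct (concat (map (lap_cells m n) ps))"
  proof (rule distinct_concat_map[OF \<open>distinct ps\<close>])
    fix p assume "p \<in> set ps"
    then have "fst p < m" "snd p < n" by (rule bound)+
    then show "distinct (lap_cells m n p)"
      by (auto simp: lap_cells_def Let_def split: prod.split)
  next
    fix p p' assume "p \<in> set ps" "p' \<in> set ps" "p \<noteq> p'"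
    then have "fst p < m" "snd p < n" "fst p' < m" "snd p' < n" "p \<noteq> p'"
      using bound by blast+
    then show "set (lap_cells m n p) \<inter> set (lap_cells m n p') = {}"
      by (auto simp: lap_cells_def Let_def split: prod.splits)
  qed
  moreover have "distinct (mark_cells m n)" by (auto simp: mark_cells_def Let_def)
  moreover have "set (lap_cells m n p) \<inter> set (mark_cells m n) = {}" if "p \<in> set ps" for p
    using bound[OF that] by (cases p) (auto simp: lap_cells_def mark_cells_def Let_def)
  ultimately show ?thesis
    unfolding enumerates_nz_def nz_positions_lap_of m_def n_def by (auto simp: set_ps)
qed

lemma nnz_enumerates: "enumerates_nz M ps \<Longrightarrow> nnz M = length ps"
  by (metis distinct_card enumerates_nz_def nnz_def)

lemma finite_nz_positions [simp]: "finite (nz_positions M)"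
  by (rule finite_subset[of _ "{..<dim_row M} \<times> {..<dim_col M}"]) (auto simp: nz_positions_def)

lemma nnz_lap_of: "nnz (lap_of M) = 8 * nnz M + 4"
proof -
  obtain ps where "enumerates_nz M ps"
    using finite_distinct_list[OF finite_nz_positions[of M]] by (auto simp: enumerates_nz_def)
  then show ?thesis
    using nnz_enumerates[OF enumerates_lap_of[of M ps]] nnz_enumerates[of M ps]
    by (simp add: mark_cells_def Let_def length_concat comp_def sum_list_triv)
qed

section \<open>Transfer of solutions between the two systems\<close>

lemma lap_of_mult_vec_row:
  fixes M :: "'a::field mat"
  defines "m \<equiv> dim_row M" and "n \<equiv> dim_col M"
  assumes "dim_vec z = lap_dim m n" "i < m"
  shows "(lap_of M *\<^sub>v z) $ i =
    (\<Sum>j<n. M $$ (i, j) * (z $ (2 * m + 2 * n - j) - z $ (2 * m + n - 1 - j)))"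
  using assms lap_of_mult_vec[of i M z]
  by (simp add: row_sign_def col_sign_def mark_sign_def row_index_def)

text \<open>
  A row without non-zero entries is not visited by the reduction; its right-hand side stays at an
  isolated vertex, so that the system is unsolvable unless that right-hand side is \<open>0\<close>.
\<close>

definition lap_rhs :: "nat \<Rightarrow> 'a::field vec \<Rightarrow> nat set \<Rightarrow> nat \<Rightarrow> 'a" where
  "lap_rhs m c R i =
    (if i < m then c $ i else if i < 2 * m \<and> i - m \<in> R then - c $ (i - m) else 0)"

lemma lap_of_solvable:
  fixes M :: "'a::field mat"
  defines "m \<equiv> dim_row M" and "n \<equiv> dim_col M"
  assumes x: "solves M c x"
  shows "\<exists>z. solves (lap_of M) (vec (lap_dim m n) (lap_rhs m c (fst ` nz_positions M))) z"
proof -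
  have dx: "dim_vec x = n" and Mx: "M *\<^sub>v x = c" using x by (auto simp: solves_def n_def)
  have Mx_i: "(\<Sum>j<n. M $$ (i, j) * x $ j) = c $ i" if "i < m" for i
    using that dx unfolding Mx[symmetric] by (simp add: m_def n_def scalar_prod_def lessThan_atLeast0)
  \<comment> \<open>For an empty row the right-hand side at the negative vertex is 0 instead of
    \<open>- c $ i\<close>; solvability of the original system makes the two agree.\<close>
  have unused: "c $ i = 0" if "i < m" "i \<notin> fst ` nz_positions M" for i
  proof -
    have "M $$ (i, j) = 0" if "j < n" for j
      using that \<open>i < m\<close> \<open>i \<notin> fst ` nz_positions M\<close>
      by (force simp: nz_positions_def m_def n_def image_iff)
    then show ?thesis using Mx_i[OF \<open>i < m\<close>] by simp
  qed
  \<comment> \<open>The value of \<open>x\<close> at \<open>j\<close> is placed on the positive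
    column vertex and 0 everywhere else, so the differences over row vertices and over the extra
    edge vanish.\<close>
  define z where "z = vec (lap_dim m n)
    (\<lambda>r. if 2 * m + n < r \<and> r \<le> 2 * m + 2 * n then x $ (2 * m + 2 * n - r) else 0)"
  have dz: "dim_vec z = lap_dim m n" by (simp add: z_def)
  have "lap_of M *\<^sub>v z = vec (lap_dim m n) (lap_rhs m c (fst ` nz_positions M))"
  proof (rule eq_vecI)
    fix r assume "r < dim_vec (vec (lap_dim m n) (lap_rhs m c (fst ` nz_positions M)))"
    then have r: "r < lap_dim m n" by simp
    have cols: "(\<Sum>j<n. M $$ (row_index m r, j) * (z $ (2 * m + 2 * n - j) - z $ (2 * m + n - 1 - j)))
        = (\<Sum>j<n. M $$ (row_index m r, j) * x $ j)"
      by (rule sum.cong) (auto simp: z_def)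
    have rows: "(\<Sum>i<m. M $$ (i, col_index m n r) * (z $ i - z $ (m + i))) = 0"
      by (rule sum.neutral) (auto simp: z_def)
    have marks: "z $ (2 * m + 2 * n + 1) - z $ (2 * m + n) = 0" by (auto simp: z_def)
    have "(lap_of M *\<^sub>v z) $ r = row_sign m r * (\<Sum>j<n. M $$ (row_index m r, j) * x $ j)"
      using r dz lap_of_mult_vec[of r M z]
      unfolding m_def[symmetric] n_def[symmetric] cols rows marks by simp
    also have "\<dots> = lap_rhs m c (fst ` nz_positions M) r"
      using Mx_i[of "row_index m r"] unused[of "row_index m r"]
      by (auto simp: row_sign_def row_index_def lap_rhs_def)
    finally show "(lap_of M *\<^sub>v z) $ r = vec (lap_dim m n) (lap_rhs m c (fst ` nz_positions M)) $ r"
      using r by simp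
  qed (simp add: m_def n_def)
  moreover have "z \<in> carrier_vec (dim_col (lap_of M))"
    using dz unfolding carrier_vec_def m_def n_def by simp
  ultimately show ?thesis unfolding solves_def by blast
qed

text \<open>The equations at the positive row vertices already give the original system. The values
  of \<open>x\<close> at empty columns are free, since they are multiplied by 0.\<close>

lemma lap_of_solution:
  fixes M :: "'a::field mat"
  defines "m \<equiv> dim_row M" and "n \<equiv> dim_col M"
  assumes c: "dim_vec c = m"
    and z: "solves (lap_of M) (vec (lap_dim m n) (lap_rhs m c R)) z"
    and x: "\<And>i j. (i, j) \<in> nz_positions M \<Longrightarrow>
      x j = z $ (2 * m + 2 * n - j) - z $ (2 * m + n - 1 - j)"
  shows "solves M c (vec n x)"
proof -
  have dz: "dim_vec z = lap_dim m n" and Lz: "lap_of M *\<^sub>v z = vec (lap_dim m n) (lap_rhs m c R)"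
    using z by (auto simp: solves_def m_def n_def)
  have "M *\<^sub>v vec n x = c"
  proof (rule eq_vecI)
    fix i assume "i < dim_vec c"
    then have i: "i < m" using c by simp
    have "(M *\<^sub>v vec n x) $ i = (\<Sum>j<n. M $$ (i, j) * x j)"
      using i by (simp add: m_def n_def scalar_prod_def lessThan_atLeast0)
    also have "\<dots> = (\<Sum>j<n. M $$ (i, j) * (z $ (2 * m + 2 * n - j) - z $ (2 * m + n - 1 - j)))"
    proof (rule sum.cong)
      fix j assume "j \<in> {..<n}"
      then have "M $$ (i, j) \<noteq> 0 \<Longrightarrow> (i, j) \<in> nz_positions M"
        using i by (simp add: nz_positions_def m_def n_def)
      then show "M $$ (i, j) * x j =
          M $$ (i, j) * (z $ (2 * m + 2 * n - j) - z $ (2 * m + n - 1 - j))"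
        using x[of i j] by (cases "M $$ (i, j) = 0") auto
    qed simp
    also have "\<dots> = (lap_of M *\<^sub>v z) $ i"
      using lap_of_mult_vec_row[of z M i] dz i by (simp add: m_def n_def)
    also have "\<dots> = c $ i" using i unfolding Lz by (simp add: lap_rhs_def)
    finally show "(M *\<^sub>v vec n x) $ i = c $ i" .
  qed (simp add: c m_def)
  then show ?thesis by (auto simp: solves_def n_def)
qed

section \<open>Total correctness of programs\<close>

text \<open>A functional semantics that the simplifier can evaluate on loop-free code; the clause
  for \<open>While\<close> is only a placeholder.\<close>

fun run :: "'a::field com \<Rightarrow> 'a state \<Rightarrow> 'a state" where
  "run Skip s = s"
| "run (NSet r e) s = s\<lparr>nreg := (nreg s)(r := neval s e)\<rparr>"
| "run (NStore a i e) s = s\<lparr>narr := (narr s)(a := (narr s a)(neval s i := neval s e))\<rparr>"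
| "run (FSet r e) s = s\<lparr>freg := (freg s)(r := feval s e)\<rparr>"
| "run (FStore a i e) s = s\<lparr>farr := (farr s)(a := (farr s a)(neval s i := feval s e))\<rparr>"
| "run (Seq c1 c2) s = run c2 (run c1 s)"
| "run (If b c1 c2) s = (if beval s b then run c1 s else run c2 s)"
| "run (While b c) s = s"

text \<open>\<open>safe\<close> is restricted to loop-free programs.\<close>

fun safe :: "nat \<Rightarrow> 'a::field com \<Rightarrow> 'a state \<Rightarrow> bool" where
  "safe W Skip s \<longleftrightarrow> True"
| "safe W (NSet r e) s \<longleftrightarrow> neval s e \<le> W"
| "safe W (NStore a i e) s \<longleftrightarrow> neval s i \<le> W \<and> neval s e \<le> W"
| "safe W (FSet r e) s \<longleftrightarrow> True"
| "safe W (FStore a i e) s \<longleftrightarrow> neval s i \<le> W"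
| "safe W (Seq c1 c2) s \<longleftrightarrow> safe W c1 s \<and> safe W c2 (run c1 s)"
| "safe W (If b c1 c2) s \<longleftrightarrow> (if beval s b then safe W c1 s else safe W c2 s)"
| "safe W (While b c) s \<longleftrightarrow> False"

fun cost :: "'a com \<Rightarrow> nat" where
  "cost (Seq c1 c2) = cost c1 + cost c2"
| "cost (If b c1 c2) = max (cost c1) (cost c2) + 1"
| "cost _ = 1"

definition halts :: "nat \<Rightarrow> 'a::field com \<Rightarrow> 'a state \<Rightarrow> nat \<Rightarrow> ('a state \<Rightarrow> bool) \<Rightarrow> bool" where
  "halts W c s B P \<longleftrightarrow> (\<exists>t s'. exec W c s t s' \<and> t \<le> B \<and> P s')"

lemma exec_run: "safe W c s \<Longrightarrow> \<exists>t\<le>cost c. exec W c s t (run c s)"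
proof (induction c arbitrary: s)
  case (Seq c1 c2)
  then obtain t1 t2 where "t1 \<le> cost c1" "exec W c1 s t1 (run c1 s)"
    "t2 \<le> cost c2" "exec W c2 (run c1 s) t2 (run c2 (run c1 s))" by fastforce
  then show ?case by (intro exI[of _ "t1 + t2"]) (auto intro: exec.Seq)
next
  case (If b c1 c2)
  show ?case
  proof (cases "beval s b")
    case True
    then obtain t where "t \<le> cost c1" "exec W c1 s t (run c1 s)" using If by fastforce
    then show ?thesis using True by (intro exI[of _ "t + 1"]) (auto intro: exec.IfTrue[simplified])
  next
    case False
    then obtain t where "t \<le> cost c2" "exec W c2 s t (run c2 s)" using If by fastforce
    then show ?thesis using False by (intro exI[of _ "t + 1"]) (auto intro: exec.IfFalse[simplified])
  qed
qed (auto intro: exec.intros[simplified])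

lemma halts_run: "safe W c s \<Longrightarrow> P (run c s) \<Longrightarrow> halts W c s (cost c) P"
  using exec_run[of W c s] by (auto simp: halts_def)

lemma halts_Seq:
  assumes "halts W c1 s B1 Q" "\<And>s'. Q s' \<Longrightarrow> halts W c2 s' B2 P"
  shows "halts W (Seq c1 c2) s (B1 + B2) P"
proof -
  obtain t1 s1 where 1: "exec W c1 s t1 s1" "t1 \<le> B1" "Q s1" using assms(1) by (auto simp: halts_def)
  obtain t2 s2 where 2: "exec W c2 s1 t2 s2" "t2 \<le> B2" "P s2"
    using assms(2)[OF 1(3)] by (auto simp: halts_def)
  show ?thesis unfolding halts_def
    using exec.Seq[OF 1(1) 2(1)] 1 2 by (intro exI[of _ "t1 + t2"] exI[of _ s2]) simp
qed

text \<open>The index of the invariant counts the remaining iterations, so it serves as termination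
  measure and as time bound: each iteration costs \<open>B\<close> plus one test, and the last test
  fails.\<close>

lemma halts_countdown:
  assumes "I q s"
    and step: "\<And>r s. I (Suc r) s \<Longrightarrow> beval s b \<and> halts W c s B (I r)"
    and stop: "\<And>s. I 0 s \<Longrightarrow> \<not> beval s b"
  shows "halts W (While b c) s (q * (B + 1) + 1) (I 0)"
  using assms(1)
proof (induction q arbitrary: s)
  case 0
  then show ?case using stop[OF 0] exec.WhileFalse[of s b W c] by (auto simp: halts_def)
next
  case (Suc q)
  obtain t1 s1 where 1: "exec W c s t1 s1" "t1 \<le> B" "I q s1"
    using step[OF Suc.prems] by (auto simp: halts_def)
  obtain t2 s2 where 2: "exec W (While b c) s1 t2 s2" "t2 \<le> q * (B + 1) + 1" "I 0 s2"
    using Suc.IH[OF 1(3)] by (auto simp: halts_def)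
  have "exec W (While b c) s (t1 + t2 + 1) s2"
    using exec.WhileTrue[OF _ 1(1) 2(1)] step[OF Suc.prems] by simp
  then show ?case unfolding halts_def using 1 2
    by (intro exI[of _ "t1 + t2 + 1"] exI[of _ s2]) simp
qed

section \<open>The reduction\<close>

fun seqs :: "'a com list \<Rightarrow> 'a com" where
  "seqs [] = Skip"
| "seqs (c # cs) = Seq c (seqs cs)"

definition emit :: "nat \<Rightarrow> nexp \<Rightarrow> nexp \<Rightarrow> 'a fexp \<Rightarrow> 'a com" where
  "emit t r c v = (let k = NAdd (NReg ''w'') (NConst t) in
     Seq (NStore ''row'' k r) (Seq (NStore ''col'' k c) (FStore ''val'' k v)))"

text \<open>Lacking multiplication, \<open>''w''\<close> becomes eight times the number of entries
  by three doublings. The extra edge is written there, behind all blocks and all input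
  entries.\<close>

definition reduce_init :: "'a::field com" where
  "reduce_init = seqs [
     NSet ''m'' (NReg ''rows''), NSet ''n'' (NReg ''cols''), NSet ''k'' (NReg ''nnz''),
     NSet ''b'' (NAdd (NAdd (NReg ''m'') (NReg ''m'')) (NReg ''n'')),
     NSet ''a'' (NAdd (NAdd (NReg ''b'') (NReg ''n'')) (NConst 1)),
     NSet ''rows'' (NAdd (NReg ''a'') (NConst 1)), NSet ''cols'' (NReg ''rows''),
     NSet ''w'' (NAdd (NReg ''k'') (NReg ''k'')), NSet ''w'' (NAdd (NReg ''w'') (NReg ''w'')),
     NSet ''w'' (NAdd (NReg ''w'') (NReg ''w'')), NSet ''nnz'' (NAdd (NReg ''w'') (NConst 4)),
     emit 0 (NReg ''a'') (NReg ''a'') (FConst 1), emit 1 (NReg ''a'') (NReg ''b'') (FConst (- 1)),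
     emit 2 (NReg ''b'') (NReg ''a'') (FConst (- 1)), emit 3 (NReg ''b'') (NReg ''b'') (FConst 1)]"

text \<open>
  The loop runs downwards because entry \<open>k\<close> of the input is replaced by the entries
  \<open>8 * k, \<dots>, 8 * k + 7\<close> of the output in the same arrays.
\<close>

definition reduce_body :: "'a::field com" where
  "reduce_body = seqs [
     NSet ''k'' (NSub (NReg ''k'') (NConst 1)), NSet ''w'' (NSub (NReg ''w'') (NConst 8)),
     NSet ''i'' (NLoad ''row'' (NReg ''k'')), NSet ''h'' (NAdd (NReg ''m'') (NReg ''i'')),
     NSet ''p'' (NSub (NSub (NReg ''a'') (NConst 1)) (NLoad ''col'' (NReg ''k''))),
     NSet ''q'' (NSub (NSub (NReg ''b'') (NConst 1)) (NLoad ''col'' (NReg ''k''))),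
     FSet ''v'' (FLoad ''val'' (NReg ''k'')), FSet ''u'' (FSub (FConst 0) (FReg ''v'')),
     emit 0 (NReg ''i'') (NReg ''p'') (FReg ''v''), emit 1 (NReg ''i'') (NReg ''q'') (FReg ''u''),
     emit 2 (NReg ''h'') (NReg ''p'') (FReg ''u''), emit 3 (NReg ''h'') (NReg ''q'') (FReg ''v''),
     emit 4 (NReg ''p'') (NReg ''i'') (FReg ''v''), emit 5 (NReg ''q'') (NReg ''i'') (FReg ''u''),
     emit 6 (NReg ''p'') (NReg ''h'') (FReg ''u''), emit 7 (NReg ''q'') (NReg ''h'') (FReg ''v''),
     FStore ''rhs'' (NReg ''h'') (FSub (FConst 0) (FLoad ''rhs'' (NReg ''i'')))]"

definition reduce_prog :: "'a::field com" where
  "reduce_prog = Seq reduce_init (While (NLess (NConst 0) (NReg ''k'')) reduce_body)"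

text \<open>Positions below \<open>r\<close> still hold input and those from \<open>8 * r\<close> on
  hold final output. Demanding the exact list, in the order in which the programs emit cells, lets
  \<open>enumerates_lap_of\<close> yield the output condition at \<open>r = 0\<close>.\<close>

definition reduce_inv :: "'a::field mat \<Rightarrow> 'a vec \<Rightarrow> (nat \<times> nat) list \<Rightarrow> nat \<Rightarrow> 'a state \<Rightarrow> bool" where
  "reduce_inv M c ps r s \<longleftrightarrow> (let m = dim_row M; n = dim_col M; l = 8 * length ps + 4 in
     r \<le> length ps \<and> nreg s ''m'' = m \<and> nreg s ''n'' = n \<and> nreg s ''k'' = r \<and> nreg s ''w'' = 8 * r \<and>
     nreg s ''a'' = 2 * m + 2 * n + 1 \<and> nreg s ''b'' = 2 * m + n \<and>
     nreg s ''rows'' = lap_dim m n \<and> nreg s ''cols'' = lap_dim m n \<and> nreg s ''nnz'' = l \<and>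
     (\<forall>k<r. narr s ''row'' k = fst (ps ! k) \<and> narr s ''col'' k = snd (ps ! k) \<and>
        farr s ''val'' k = M $$ (ps ! k)) \<and>
     map (\<lambda>k. (narr s ''row'' k, narr s ''col'' k)) [8 * r..<l] =
        concat (map (lap_cells m n) (drop r ps)) @ mark_cells m n \<and>
     (\<forall>k\<in>{8 * r..<l}. farr s ''val'' k = lap_of M $$ (narr s ''row'' k, narr s ''col'' k)) \<and>
     farr s ''rhs'' = lap_rhs m c (fst ` set (drop r ps)))"

text \<open>The bound on \<open>W\<close> covers the new dimension \<open>2 * m + 2 * n + 2\<close>
  and the new number of entries \<open>8 * length ps + 4\<close>, hence all vertices and
  addresses.\<close>

lemma reduce_init_correct:
  fixes M :: "'a::field mat"
  assumes c: "lin_instance M c"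
    and W: "8 * (dim_row M + dim_col M + length ps + 2) \<le> W"
  shows "halts W reduce_init (input_state M c ps) (cost (reduce_init :: 'a com))
    (reduce_inv M c ps (length ps))"
proof (rule halts_run)
  show "safe W reduce_init (input_state M c ps)"
    using W by (simp add: reduce_init_def emit_def Let_def input_state_def)
  define m n l where "m = dim_row M" and "n = dim_col M" and "l = 8 * length ps"
  have dc: "dim_vec c = m" using c by (simp add: lin_instance_def m_def)
  define s0 s where "s0 = input_state M c ps" and "s = run reduce_init s0"
  have reg0: "nreg s0 ''rows'' = m" "nreg s0 ''cols'' = n" "nreg s0 ''nnz'' = length ps"
    by (simp_all add: s0_def input_state_def m_def n_def)
  have dbl: "x + x = 2 * x" "2 * x + 2 * x = 4 * x" "4 * x + 4 * x = 8 * x" for x :: nat by simp_all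
  have nreg: "nreg s = (nreg s0)(''m'' := m, ''n'' := n, ''k'' := length ps, ''b'' := 2 * m + n,
      ''a'' := 2 * m + 2 * n + 1, ''rows'' := lap_dim m n, ''cols'' := lap_dim m n,
      ''w'' := l, ''nnz'' := l + 4)"
    by (auto simp: s_def reduce_init_def emit_def Let_def reg0 l_def)
  have row: "narr s ''row'' = (narr s0 ''row'')(l := 2 * m + 2 * n + 1, l + 1 := 2 * m + 2 * n + 1,
      l + 2 := 2 * m + n, l + 3 := 2 * m + n)"
    by (simp add: s_def reduce_init_def emit_def Let_def reg0 l_def dbl add.commute)
  have col: "narr s ''col'' = (narr s0 ''col'')(l := 2 * m + 2 * n + 1, l + 1 := 2 * m + n,
      l + 2 := 2 * m + 2 * n + 1, l + 3 := 2 * m + n)"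
    by (simp add: s_def reduce_init_def emit_def Let_def reg0 l_def dbl add.commute)
  have val: "farr s ''val'' = (farr s0 ''val'')(l := 1, l + 1 := - 1, l + 2 := - 1, l + 3 := 1)"
    by (simp add: s_def reduce_init_def emit_def Let_def reg0 l_def dbl)
  have rhs: "farr s ''rhs'' = lap_rhs m c {}"
    using dc by (auto simp: s_def reduce_init_def emit_def Let_def s0_def input_state_def lap_rhs_def fun_eq_iff)
  have cells: "map (\<lambda>k. (narr s ''row'' k, narr s ''col'' k)) [l..<l + 4] = mark_cells m n"
    unfolding row col mark_cells_def Let_def by (simp add: upt_conv_Cons)
  have vals: "farr s ''val'' k = lap_of M $$ (narr s ''row'' k, narr s ''col'' k)"
    if "l \<le> k" "k < l + 4" for k
  proof -
    have "k \<in> {l, l + 1, l + 2, l + 3}" using that by auto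
    then show ?thesis
      using lap_of_mark_cells[of M] unfolding row col val m_def n_def by auto
  qed
  have input: "narr s ''row'' k = fst (ps ! k)" "narr s ''col'' k = snd (ps ! k)"
    "farr s ''val'' k = M $$ (ps ! k)" if "k < length ps" for k
    using that by (simp_all add: row col val l_def s0_def input_state_def)
  show "reduce_inv M c ps (length ps) (run reduce_init (input_state M c ps))"
    unfolding reduce_inv_def Let_def m_def[symmetric] n_def[symmetric] l_def[symmetric]
      s0_def[symmetric] s_def[symmetric]
    using input cells vals rhs by (simp add: nreg)
qed

lemma reduce_body_correct:
  fixes M :: "'a::field mat"
  assumes c: "dim_vec c = dim_row M" and ps: "enumerates_nz M ps"
    and W: "8 * (dim_row M + dim_col M + length ps + 2) \<le> W"
    and inv: "reduce_inv M c ps (Suc r) s"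
  shows "halts W reduce_body s (cost (reduce_body :: 'a com)) (reduce_inv M c ps r)"
proof (rule halts_run)
  define m n where "m = dim_row M" and "n = dim_col M"
  obtain i j where ij: "ps ! r = (i, j)" by force
  have r: "r < length ps" using inv by (simp add: reduce_inv_def Let_def)
  then have "(i, j) \<in> nz_positions M" using ps ij nth_mem[OF r] by (simp add: enumerates_nz_def)
  then have bd: "i < m" "j < n" by (auto simp: nz_positions_def m_def n_def)
  have reg: "nreg s ''m'' = m" "nreg s ''n'' = n" "nreg s ''k'' = Suc r" "nreg s ''w'' = 8 + 8 * r"
     "nreg s ''a'' = Suc (2 * m + 2 * n)" "nreg s ''b'' = 2 * m + n"
     "nreg s ''rows'' = lap_dim m n" "nreg s ''cols'' = lap_dim m n" "nreg s ''nnz'' = 8 * length ps + 4"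
     and here: "narr s ''row'' r = i" "narr s ''col'' r = j" "farr s ''val'' r = M $$ (i, j)"
    using inv ij by (auto simp: reduce_inv_def Let_def m_def n_def)
  show "safe W reduce_body s"
    using W bd r by (auto simp add: reduce_body_def emit_def Let_def reg here m_def[symmetric] n_def[symmetric])
  define p q v where "p = 2 * m + 2 * n - j" and "q = 2 * m + n - Suc j" and "v = M $$ (i, j)"
  define s' where "s' = run reduce_body s"
  have s'_n: "nreg s' = (nreg s)(''k'' := r, ''w'' := 8 * r, ''i'' := i, ''h'' := m + i, ''p'' := p, ''q'' := q)"
    by (simp add: s'_def reduce_body_def emit_def Let_def reg here p_def q_def)
  have s'_row: "narr s' ''row'' = (narr s ''row'')(8 * r := i, 8 * r + 1 := i, 8 * r + 2 := m + i, 8 * r + 3 := m + i,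
      8 * r + 4 := p, 8 * r + 5 := q, 8 * r + 6 := p, 8 * r + 7 := q)"
    by (simp add: s'_def reduce_body_def emit_def Let_def reg here p_def q_def)
  have s'_col: "narr s' ''col'' = (narr s ''col'')(8 * r := p, 8 * r + 1 := q, 8 * r + 2 := p, 8 * r + 3 := q,
      8 * r + 4 := i, 8 * r + 5 := i, 8 * r + 6 := m + i, 8 * r + 7 := m + i)"
    by (simp add: s'_def reduce_body_def emit_def Let_def reg here p_def q_def)
  have s'_val: "farr s' ''val'' = (farr s ''val'')(8 * r := v, 8 * r + 1 := - v, 8 * r + 2 := - v, 8 * r + 3 := v,
      8 * r + 4 := v, 8 * r + 5 := - v, 8 * r + 6 := - v, 8 * r + 7 := v)"
    by (simp add: s'_def reduce_body_def emit_def Let_def reg here v_def)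
  have s'_rhs: "farr s' ''rhs'' = (farr s ''rhs'')(m + i := - farr s ''rhs'' i)"
    by (simp add: s'_def reduce_body_def emit_def Let_def reg here)
  have drop_r: "drop r ps = (i, j) # drop (Suc r) ps" using Cons_nth_drop_Suc[OF r] ij by simp
  have old_list: "map (\<lambda>k. (narr s ''row'' k, narr s ''col'' k)) [8 + 8 * r..<8 * length ps + 4] =
        concat (map (lap_cells m n) (drop (Suc r) ps)) @ mark_cells m n"
    and old_val: "\<And>k. 8 + 8 * r \<le> k \<Longrightarrow> k < 8 * length ps + 4 \<Longrightarrow>
        farr s ''val'' k = lap_of M $$ (narr s ''row'' k, narr s ''col'' k)"
    and old_rhs: "farr s ''rhs'' = lap_rhs m c (fst ` set (drop (Suc r) ps))"
    and unread: "\<And>k. k < r \<Longrightarrow> narr s ''row'' k = fst (ps ! k)"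
        "\<And>k. k < r \<Longrightarrow> narr s ''col'' k = snd (ps ! k)" "\<And>k. k < r \<Longrightarrow> farr s ''val'' k = M $$ (ps ! k)"
    using inv by (auto simp: reduce_inv_def Let_def m_def n_def)
  have split: "[8 * r..<8 * length ps + 4] = [8 * r, 8 * r + 1, 8 * r + 2, 8 * r + 3, 8 * r + 4,
      8 * r + 5, 8 * r + 6, 8 * r + 7] @ [8 + 8 * r..<8 * length ps + 4]"
  proof -
    obtain l where l: "8 * length ps + 4 = 8 * r + 8 + l"
      by (rule that[of "8 * length ps + 4 - (8 * r + 8)"]) (use r in simp)
    have "[8 * r..<8 * length ps + 4] = [8 * r..<8 * r + 8] @ [8 * r + 8..<8 * length ps + 4]"
      unfolding l by (rule upt_add_eq_append) simp
    also have "[8 * r..<8 * r + 8] = [8 * r, 8 * r + 1, 8 * r + 2, 8 * r + 3, 8 * r + 4,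
        8 * r + 5, 8 * r + 6, 8 * r + 7]"
      by (simp add: upt_conv_Cons)
    finally show ?thesis by (simp add: add.commute)
  qed
  have "map (\<lambda>k. (narr s' ''row'' k, narr s' ''col'' k)) [8 + 8 * r..<8 * length ps + 4] =
      map (\<lambda>k. (narr s ''row'' k, narr s ''col'' k)) [8 + 8 * r..<8 * length ps + 4]"
    by (rule map_cong) (auto simp: s'_row s'_col)
  then have new_list: "map (\<lambda>k. (narr s' ''row'' k, narr s' ''col'' k)) [8 * r..<8 * length ps + 4] =
        concat (map (lap_cells m n) (drop r ps)) @ mark_cells m n"
    unfolding split map_append drop_r
    by (simp add: old_list s'_row s'_col lap_cells_def p_def q_def Let_def)
  have new_val: "farr s' ''val'' k = lap_of M $$ (narr s' ''row'' k, narr s' ''col'' k)"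
    if k: "8 * r \<le> k" "k < 8 * length ps + 4" for k
  proof (cases "8 + 8 * r \<le> k")
    case True
    then show ?thesis using old_val[OF True k(2)] by (simp add: s'_row s'_col s'_val)
  next
    case False
    then have "k \<in> {8 * r, 8 * r + 1, 8 * r + 2, 8 * r + 3, 8 * r + 4, 8 * r + 5, 8 * r + 6, 8 * r + 7}"
      using k by auto
    then show ?thesis
      using lap_of_cells[of i M j] bd
      unfolding s'_row s'_col s'_val p_def q_def v_def m_def n_def by auto
  qed
  \<comment> \<open>A row with several entries is negated several times, but always from position
    \<open>i < m\<close>, which is never overwritten; repetition is harmless.\<close>
  have new_rhs: "farr s' ''rhs'' = lap_rhs m c (fst ` set (drop r ps))"
    using bd unfolding s'_rhs old_rhs drop_r by (auto simp: lap_rhs_def fun_eq_iff)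
  \<comment> \<open>Unread entries sit below \<open>r \<le> 8 * r\<close> and survive. Entry
    \<open>r\<close> itself may be overwritten (if \<open>r = 0\<close>), but was loaded into
    registers first.\<close>
  show "reduce_inv M c ps r (run reduce_body s)"
    unfolding reduce_inv_def Let_def m_def[symmetric] n_def[symmetric] s'_def[symmetric]
    using r unread new_list new_val new_rhs by (simp add: s'_n reg) (simp add: s'_row s'_col s'_val)
qed

lemma reduce_prog_correct:
  fixes M :: "'a::field mat"
  defines "m \<equiv> dim_row M" and "n \<equiv> dim_col M"
  assumes c: "lin_instance M c" and ps: "enumerates_nz M ps"
    and W: "8 * (m + n + length ps + 2) \<le> W"
  shows "halts W reduce_prog (input_state M c ps)
    (cost (reduce_init :: 'a com) + (length ps * (cost (reduce_body :: 'a com) + 1) + 1))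
    (\<lambda>s. outputs_instance s (lap_of M) (vec (lap_dim m n) (lap_rhs m c (fst ` nz_positions M))))"
proof -
  have dc: "dim_vec c = dim_row M" using c by (simp add: lin_instance_def)
  note W' = W[unfolded m_def n_def]
  have "halts W reduce_prog (input_state M c ps)
      (cost (reduce_init :: 'a com) + (length ps * (cost (reduce_body :: 'a com) + 1) + 1))
      (reduce_inv M c ps 0)"
    unfolding reduce_prog_def
  proof (rule halts_Seq[OF reduce_init_correct[OF c W']], rule halts_countdown)
    fix r s assume inv: "reduce_inv M c ps (Suc r) s"
    then show "beval s (NLess (NConst 0) (NReg ''k'')) \<and>
        halts W reduce_body s (cost (reduce_body :: 'a com)) (reduce_inv M c ps r)"
      using reduce_body_correct[OF dc ps W' inv] by (simp add: reduce_inv_def Let_def)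
  qed (simp_all add: reduce_inv_def Let_def)
  moreover have "outputs_instance s (lap_of M) (vec (lap_dim m n) (lap_rhs m c (fst ` nz_positions M)))"
    if "reduce_inv M c ps 0 s" for s
    using that enumerates_lap_of[OF ps] ps
    by (simp add: reduce_inv_def Let_def outputs_instance_def lin_instance_def m_def n_def enumerates_nz_def)
  ultimately show ?thesis unfolding halts_def by blast
qed

section \<open>Recovering a solution of the original system\<close>

definition mark_body :: "'a::field com" where
  "mark_body = seqs [NSet ''k'' (NSub (NReg ''k'') (NConst 1)),
     If (BAnd (NEq (NLoad ''row'' (NReg ''k'')) (NSub (NReg ''rows'') (NConst 1)))
          (NLess (NLoad ''col'' (NReg ''k'')) (NSub (NReg ''rows'') (NConst 1))))
       (NSet ''d'' (NSub (NSub (NReg ''rows'') (NConst 1)) (NLoad ''col'' (NReg ''k'')))) Skip]"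

text \<open>
  Row vertices and \<open>j\<^sup>-\<close> also occur as columns, but for them the index written to is at least \<open>n\<close>,
  outside the part of the array that is read as the output.
\<close>

definition recover_body :: "'a::field com" where
  "recover_body = seqs [NSet ''k'' (NSub (NReg ''k'') (NConst 1)), NSet ''c'' (NLoad ''col'' (NReg ''k'')),
     If (NLess (NReg ''c'') (NSub (NReg ''rows'') (NConst 1)))
       (FStore ''out'' (NSub (NSub (NReg ''rows'') (NConst 2)) (NReg ''c''))
          (FSub (FLoad ''sol'' (NReg ''c'')) (FLoad ''sol'' (NSub (NReg ''c'') (NReg ''d''))))) Skip]"

definition recover_prog :: "'a::field com" where
  "recover_prog = Seq (NSet ''k'' (NReg ''nnz'')) (Seq (While (NLess (NConst 0) (NReg ''k'')) mark_body)
     (Seq (NSet ''k'' (NReg ''nnz'')) (While (NLess (NConst 0) (NReg ''k'')) recover_body)))"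

definition sol_input :: "'a::field mat \<Rightarrow> 'a vec \<Rightarrow> (nat \<times> nat) list \<Rightarrow> nat \<Rightarrow> 'a state \<Rightarrow> bool" where
  "sol_input M z ps r s \<longleftrightarrow> r \<le> length ps \<and> nreg s ''k'' = r \<and>
     nreg s ''rows'' = lap_dim (dim_row M) (dim_col M) \<and> nreg s ''nnz'' = length ps \<and>
     (\<forall>k<length ps. narr s ''row'' k = fst (ps ! k) \<and> narr s ''col'' k = snd (ps ! k)) \<and>
     (\<forall>i<lap_dim (dim_row M) (dim_col M). farr s ''sol'' i = z $ i)"

text \<open>The entries come in arbitrary order, so \<open>''d''\<close> is known only after the
  extra edge has been scanned; this is why recovery makes a separate first pass.\<close>

definition mark_inv :: "'a::field mat \<Rightarrow> 'a vec \<Rightarrow> (nat \<times> nat) list \<Rightarrow> nat \<Rightarrow> 'a state \<Rightarrow> bool" where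
  "mark_inv M z ps r s \<longleftrightarrow> sol_input M z ps r s \<and> (\<forall>i. farr s ''out'' i = 0) \<and>
     ((2 * dim_row M + 2 * dim_col M + 1, 2 * dim_row M + dim_col M) \<in> set (drop r ps) \<longrightarrow>
       nreg s ''d'' = dim_col M + 1)"

text \<open>Columns not met so far keep the initial value 0. After the pass these are exactly the
  empty columns, where any value is allowed.\<close>

definition recover_inv :: "'a::field mat \<Rightarrow> 'a vec \<Rightarrow> (nat \<times> nat) list \<Rightarrow> nat \<Rightarrow> 'a state \<Rightarrow> bool" where
  "recover_inv M z ps r s \<longleftrightarrow> sol_input M z ps r s \<and> nreg s ''d'' = dim_col M + 1 \<and>
     (let m = dim_row M; n = dim_col M in \<forall>j<n. farr s ''out'' j =
       (if 2 * m + 2 * n - j \<in> snd ` set (drop r ps)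
        then z $ (2 * m + 2 * n - j) - z $ (2 * m + n - 1 - j) else 0))"

text \<open>The last row meets only the extra edge. Its single off-diagonal entry is what
  \<open>mark_body\<close> looks for, and the distance to the diagonal is
  \<open>n + 1\<close>.\<close>

lemma nz_positions_lap_of_mark_row:
  assumes "(2 * dim_row M + 2 * dim_col M + 1, c) \<in> nz_positions (lap_of M)"
  shows "c = 2 * dim_row M + 2 * dim_col M + 1 \<or> c = 2 * dim_row M + dim_col M"
  using assms unfolding nz_positions_lap_of
  by (auto simp: lap_cells_def mark_cells_def Let_def nz_positions_def)

lemma mark_body_correct:
  fixes M :: "'a::field mat"
  assumes ps: "enumerates_nz (lap_of M) ps"
    and W: "lap_dim (dim_row M) (dim_col M) + length ps \<le> W"
    and inv: "mark_inv M z ps (Suc r) s"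
  shows "halts W mark_body s (cost (mark_body :: 'a com)) (mark_inv M z ps r)"
proof (rule halts_run)
  have r: "r < length ps" using inv by (simp add: mark_inv_def sol_input_def)
  have reg: "nreg s ''k'' = Suc r" "nreg s ''rows'' = lap_dim (dim_row M) (dim_col M)"
      "narr s ''row'' r = fst (ps ! r)" "narr s ''col'' r = snd (ps ! r)"
    using inv r by (auto simp: mark_inv_def sol_input_def)
  show "safe W mark_body s" using W r by (auto simp: mark_body_def reg)
  have "ps ! r \<in> nz_positions (lap_of M)" using ps nth_mem[OF r] by (simp add: enumerates_nz_def)
  then have "fst (ps ! r) = 2 * dim_row M + 2 * dim_col M + 1 \<Longrightarrow>
      snd (ps ! r) = 2 * dim_row M + 2 * dim_col M + 1 \<or> snd (ps ! r) = 2 * dim_row M + dim_col M"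
    using nz_positions_lap_of_mark_row[of M "snd (ps ! r)"] by (metis prod.collapse)
  then show "mark_inv M z ps r (run mark_body s)"
    using inv r unfolding mark_inv_def Cons_nth_drop_Suc[OF r, symmetric]
    by (auto simp: mark_body_def reg sol_input_def prod_eq_iff)
qed

lemma recover_body_correct:
  fixes M :: "'a::field mat"
  assumes ps: "enumerates_nz (lap_of M) ps"
    and W: "lap_dim (dim_row M) (dim_col M) + length ps \<le> W"
    and inv: "recover_inv M z ps (Suc r) s"
  shows "halts W recover_body s (cost (recover_body :: 'a com)) (recover_inv M z ps r)"
proof (rule halts_run)
  define m n where "m = dim_row M" and "n = dim_col M"
  have r: "r < length ps" using inv by (simp add: recover_inv_def sol_input_def)
  have reg: "nreg s ''k'' = Suc r" "nreg s ''rows'' = lap_dim m n" "nreg s ''d'' = n + 1"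
      "narr s ''col'' r = snd (ps ! r)"
    and sol: "\<And>i. i < lap_dim m n \<Longrightarrow> farr s ''sol'' i = z $ i"
    and out: "\<And>j. j < n \<Longrightarrow> farr s ''out'' j = (if 2 * m + 2 * n - j \<in> snd ` set (drop (Suc r) ps)
        then z $ (2 * m + 2 * n - j) - z $ (2 * m + n - 1 - j) else 0)"
    using inv r by (auto simp: recover_inv_def sol_input_def m_def n_def Let_def)
  have "ps ! r \<in> nz_positions (lap_of M)" using ps nth_mem[OF r] by (simp add: enumerates_nz_def)
  then have col: "snd (ps ! r) < lap_dim m n" by (auto simp: nz_positions_def m_def n_def)
  show "safe W recover_body s"
    using W r col unfolding m_def[symmetric] n_def[symmetric] by (auto simp: recover_body_def reg)
  define s' where "s' = run recover_body s"
  have "farr s' ''out'' j = (if 2 * m + 2 * n - j \<in> snd ` set (drop r ps)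
      then z $ (2 * m + 2 * n - j) - z $ (2 * m + n - 1 - j) else 0)" if j: "j < n" for j
  proof (cases "snd (ps ! r) = 2 * m + 2 * n - j")
    case True
    then have "farr s' ''out'' j = z $ (2 * m + 2 * n - j) - z $ (2 * m + 2 * n - j - (n + 1))"
      using j by (simp add: s'_def recover_body_def reg sol)
    moreover have "2 * m + 2 * n - j - (n + 1) = 2 * m + n - 1 - j" using j by simp
    ultimately show ?thesis using True by (simp add: Cons_nth_drop_Suc[OF r, symmetric])
  next
    \<comment> \<open>The index written to is \<open>2 * m + 2 * n - c\<close>, which differs from
      \<open>j\<close> for every other \<open>c\<close> that passes the test. The last vertex must
      fail it, since truncated subtraction would send it to index 0.\<close>
    case False
    then have "farr s' ''out'' j = farr s ''out'' j"
      using j by (auto simp: s'_def recover_body_def reg)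
    then show ?thesis using False out[OF j] by (auto simp: Cons_nth_drop_Suc[OF r, symmetric])
  qed
  moreover have "sol_input M z ps r s'" "nreg s' ''d'' = n + 1"
    using inv r by (auto simp: s'_def recover_body_def recover_inv_def sol_input_def n_def)
  ultimately show "recover_inv M z ps r (run recover_body s)"
    unfolding recover_inv_def Let_def m_def[symmetric] n_def[symmetric] s'_def[symmetric] by blast
qed

lemma recover_prog_correct:
  fixes M :: "'a::field mat"
  defines "m \<equiv> dim_row M" and "n \<equiv> dim_col M"
  assumes c: "dim_vec c = m" and ps: "enumerates_nz (lap_of M) ps"
    and z: "solves (lap_of M) (vec (lap_dim m n) (lap_rhs m c R)) z"
    and W: "lap_dim m n + length ps \<le> W"
  shows "halts W recover_prog (input_state_sol (lap_of M) c2 ps z)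
    (1 + ((length ps * (cost (mark_body :: 'a com) + 1) + 1) +
      (1 + (length ps * (cost (recover_body :: 'a com) + 1) + 1))))
    (\<lambda>s. solves M c (output_vector n s))"
proof -
  let ?b = "NLess (NConst 0) (NReg ''k'') :: 'a bexp" and ?l = "length ps"
  let ?N = "NSet ''k'' (NReg ''nnz'') :: 'a com"
  note W' = W[unfolded m_def n_def]
  have cost_N: "cost ?N = 1" by simp
  have dz: "dim_vec z = lap_dim m n" using z by (auto simp: solves_def m_def n_def)
  have init: "halts W ?N (input_state_sol (lap_of M) c2 ps z) 1 (mark_inv M z ps ?l)"
    unfolding cost_N[symmetric] using dz W
    by (intro halts_run)
      (auto simp: input_state_sol_def input_state_def mark_inv_def sol_input_def Let_def m_def n_def)
  have marks: "halts W (While ?b mark_body) s (?l * (cost (mark_body :: 'a com) + 1) + 1) (mark_inv M z ps 0)"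
    if "mark_inv M z ps ?l s" for s
    using that
  proof (rule halts_countdown)
    fix r s assume inv: "mark_inv M z ps (Suc r) s"
    then show "beval s ?b \<and> halts W mark_body s (cost (mark_body :: 'a com)) (mark_inv M z ps r)"
      using mark_body_correct[OF ps W' inv] by (simp add: mark_inv_def sol_input_def)
  qed (simp add: mark_inv_def sol_input_def)
  have between: "halts W ?N s 1 (recover_inv M z ps ?l)" if "mark_inv M z ps 0 s" for s
  proof -
    have "(2 * dim_row M + 2 * dim_col M + 1, 2 * dim_row M + dim_col M) \<in> set ps"
      using ps unfolding enumerates_nz_def nz_positions_lap_of by (auto simp: mark_cells_def Let_def)
    then show ?thesis unfolding cost_N[symmetric] using that W
      by (intro halts_run) (auto simp: mark_inv_def recover_inv_def sol_input_def Let_def)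
  qed
  have recover: "halts W (While ?b recover_body) s (?l * (cost (recover_body :: 'a com) + 1) + 1)
      (recover_inv M z ps 0)" if "recover_inv M z ps ?l s" for s
    using that
  proof (rule halts_countdown)
    fix r s assume inv: "recover_inv M z ps (Suc r) s"
    then show "beval s ?b \<and> halts W recover_body s (cost (recover_body :: 'a com)) (recover_inv M z ps r)"
      using recover_body_correct[OF ps W' inv] by (simp add: recover_inv_def sol_input_def)
  qed (simp add: recover_inv_def sol_input_def)
  have "solves M c (output_vector n s)" if s: "recover_inv M z ps 0 s" for s
    unfolding output_vector_def n_def
  proof (rule lap_of_solution[OF c[unfolded m_def] z[unfolded m_def n_def]])
    fix i j assume ij: "(i, j) \<in> nz_positions M"
    \<comment> \<open>Every non-empty column is met, because each entry of \<open>M\<close> has a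
      cell in the column of its positive column vertex.\<close>
    then have "(i, 2 * m + 2 * n - j) \<in> set ps"
      using ps unfolding enumerates_nz_def nz_positions_lap_of m_def n_def
      by (force simp: lap_cells_def Let_def)
    then have "2 * m + 2 * n - j \<in> snd ` set ps" by force
    moreover have "j < n" using ij by (auto simp: nz_positions_def n_def)
    ultimately show "farr s ''out'' j = z $ (2 * dim_row M + 2 * dim_col M - j) -
        z $ (2 * dim_row M + dim_col M - 1 - j)"
      using s by (simp add: recover_inv_def Let_def m_def n_def)
  qed
  moreover have "halts W recover_prog (input_state_sol (lap_of M) c2 ps z)
      (1 + ((?l * (cost (mark_body :: 'a com) + 1) + 1) +
        (1 + (?l * (cost (recover_body :: 'a com) + 1) + 1)))) (recover_inv M z ps 0)"
    unfolding recover_prog_def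
    by (rule halts_Seq[OF init halts_Seq[OF marks halts_Seq[OF between recover]]])
  ultimately show ?thesis unfolding halts_def by blast
qed

section \<open>Word size, running times and the final reduction\<close>

lemma word_bound_ge: "8 * (dim_row M + dim_col M + nnz M + 2) \<le> word_bound 4 M"
proof -
  let ?x = "dim_row M + dim_col M + nnz M + 2"
  \<comment> \<open>The base is at least 2, so three of the four factors absorb the constant
    8.\<close>
  have "2 ^ 3 \<le> ?x ^ 3" by (rule power_mono) auto
  then have "8 * ?x \<le> ?x ^ 3 * ?x" by (intro mult_right_mono) auto
  then show ?thesis unfolding word_bound_def by (simp add: power_eq_if mult.assoc)
qed

lemma efficient_reduction_lap_of:
  "efficient_reduction (\<lambda>x. 8 * x + 4) general_matrices laplacian_matrices
     (reduce_prog :: 'a::field com) recover_prog"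
proof -
  \<comment> \<open>One constant for both programs. The factor 8 pays for the
    \<open>8 * nnz M + 4\<close> entries scanned twice in recovery, and \<open>N + 1\<close> in
    \<open>T\<close> for the constant cost on a zero matrix.\<close>
  define C where "C = cost (reduce_init :: 'a com) + cost (reduce_body :: 'a com) + 2 +
    8 * (cost (mark_body :: 'a com) + cost (recover_body :: 'a com) + 3)"
  define T where "T N = real (C * (N + 1))" for N
  have "(\<lambda>N. real (C * (N + 1))) \<in> O(\<lambda>N. real N)"
  proof (rule bigoI[where c = "2 * real C"])
    show "\<forall>\<^sub>F N in sequentially. norm (real (C * (N + 1))) \<le> 2 * real C * norm (real N)"
      using eventually_ge_at_top[of 1]
    proof eventually_elim
      case (elim N)
      have "C * (N + 1) \<le> C * (2 * N)" using elim by (intro mult_left_mono) auto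
      then have "real (C * (N + 1)) \<le> real (C * (2 * N))" by (rule of_nat_mono)
      then show ?case by (simp add: algebra_simps)
    qed
  qed
  \<comment> \<open>The bound is linear, so exponent 0 of the iterated logarithm suffices.\<close>
  then have T: "T \<in> soft_O real"
    unfolding soft_O_def T_def by (intro UN_I[of 0]) simp_all
  show ?thesis unfolding efficient_reduction_def
  proof (rule bexI[OF _ T], rule exI[of _ 4], intro ballI allI impI)
    fix M :: "'a mat" and c ps
    assume c: "lin_instance M c" and ps: "enumerates_nz M ps"
    have q: "nnz M = length ps" by (rule nnz_enumerates[OF ps])
    have dc: "dim_vec c = dim_row M" using c by (simp add: lin_instance_def)
    define c2 where "c2 = vec (lap_dim (dim_row M) (dim_col M))
      (lap_rhs (dim_row M) c (fst ` nz_positions M))"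
    obtain t s where ts: "exec (word_bound 4 M) reduce_prog (input_state M c ps) t s"
      "t \<le> cost (reduce_init :: 'a com) + (length ps * (cost (reduce_body :: 'a com) + 1) + 1)"
      "outputs_instance s (lap_of M) c2"
      using reduce_prog_correct[OF c ps word_bound_ge[of M, unfolded q]]
      unfolding halts_def c2_def by blast
    have "t \<le> C * (nnz M + 1)"
      by (rule order.trans[OF ts(2)]) (simp add: C_def q algebra_simps)
    then have t: "real t \<le> T (nnz M)" unfolding T_def by (rule of_nat_mono)
    have "\<exists>t' s'. exec (word_bound 4 (lap_of M)) recover_prog (input_state_sol (lap_of M) c2 ps2 z) t' s' \<and>
        real t' \<le> T (nnz M) \<and> solves M c (output_vector (dim_col M) s')"
      if z: "solves (lap_of M) c2 z" and ps2: "enumerates_nz (lap_of M) ps2" for z ps2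
    proof -
      have l: "length ps2 = 8 * length ps + 4"
        using nnz_enumerates[OF ps2] nnz_lap_of[of M] q by simp
      have "lap_dim (dim_row M) (dim_col M) + length ps2 \<le> word_bound 4 (lap_of M)"
        using word_bound_ge[of "lap_of M"] nnz_enumerates[OF ps2] by simp
      from recover_prog_correct[OF dc ps2 z[unfolded c2_def] this, of c2]
      obtain t' s' where t's': "exec (word_bound 4 (lap_of M)) recover_prog
          (input_state_sol (lap_of M) c2 ps2 z) t' s'"
        "t' \<le> 1 + ((length ps2 * (cost (mark_body :: 'a com) + 1) + 1) +
          (1 + (length ps2 * (cost (recover_body :: 'a com) + 1) + 1)))"
        "solves M c (output_vector (dim_col M) s')"
        unfolding halts_def by blast
      have "t' \<le> C * (nnz M + 1)"
        by (rule order.trans[OF t's'(2)]) (simp add: C_def q l algebra_simps)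
      then have "real t' \<le> T (nnz M)" unfolding T_def by (rule of_nat_mono)
      then show ?thesis using t's' by blast
    qed
    moreover have "(\<exists>x. solves M c x) \<longrightarrow> (\<exists>z. solves (lap_of M) c2 z)"
      using lap_of_solvable unfolding c2_def by blast
    moreover have "real (sparse_complexity (lap_of M) c2) \<le> 8 * real (sparse_complexity M c) + 4"
      by (simp add: sparse_complexity_def nnz_lap_of)
    ultimately show "\<exists>t s M2 c2. exec (word_bound 4 M) reduce_prog (input_state M c ps) t s \<and>
        real t \<le> T (nnz M) \<and> outputs_instance s M2 c2 \<and> M2 \<in> laplacian_matrices \<and>
        real (sparse_complexity M2 c2) \<le> 8 * real (sparse_complexity M c) + 4 \<and>
        ((\<exists>x1. solves M c x1) \<longrightarrow> (\<exists>x2. solves M2 c2 x2)) \<and>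
        (\<forall>x2 ps2. solves M2 c2 x2 \<longrightarrow> enumerates_nz M2 ps2 \<longrightarrow>
          (\<exists>t' s'. exec (word_bound 4 M2) recover_prog (input_state_sol M2 c2 ps2 x2) t' s' \<and>
            real t' \<le> T (nnz M) \<and> solves M c (output_vector (dim_col M) s')))"
      using ts(1,3) t lap_of_laplacian[of M] by blast
  qed
qed

theorem theorem4p1:
  shows "\<exists>f :: real \<Rightarrow> real. f \<in> O(\<lambda>x. x) \<and>
    efficiently_reducible f
      (general_matrices :: 'p::prime_card mod_ring mat set) laplacian_matrices"
proof (intro exI conjI)
  show "(\<lambda>x::real. 8 * x + 4) \<in> O(\<lambda>x. x)"
  proof (rule bigoI[where c = 12])
    show "\<forall>\<^sub>F x::real in at_top. norm (8 * x + 4) \<le> 12 * norm x"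
      using eventually_ge_at_top[of 1] by eventually_elim simp
  qed
  show "efficiently_reducible (\<lambda>x. 8 * x + 4)
      (general_matrices :: 'p::prime_card mod_ring mat set) laplacian_matrices"
    unfolding efficiently_reducible_def
    using efficient_reduction_lap_of[where 'a = "'p mod_ring"] by (auto intro!: mono_onI)
qed

end
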